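(* Let $1<\alpha\le 2$, $1<\gamma\le 2$, $\lambda\ge 0$, $\beta=\gamma-1$. Let $u(x,t)$ be the exact solution on $(0,b)\times(0,T]$ of $$\frac{\partial}{\partial t}u(x,t)=\frac{1}{\Gamma(\gamma-1)}\int_0^t(t-s)^{\gamma-2}e^{-\lambda(t-s)}\nabla_x^\alpha u(x,s)\,ds+f(x,t)$$ with $u(x,0)=0$ and $u(0,t)=u(b,t)=0$, and let $u_i^n$ be the solution of the finite difference scheme $$u_i^{n+1}-u_i^n=\frac{\tau^{\gamma}}{2}\sum_{k=0}^{n}l_k^{\beta}\,\nabla_h^{\alpha}\left(u_i^{n+1-k}+u_i^{n-k}\right)+\tau f_i^{n+\frac12},\qquad 1\le i\le M-1,\ 0\le n\le N-1,$$ with $u_i^0=0$ for $0\le i\le M$ and $u_0^n=u_M^n=0$ for $0\le n\le N$. Let $C_u>0$ be a constant independent of $\tau$ and $h$ such that the residuals $$R_i^{n+1}=u(x_i,t_{n+1})-u(x_i,t_n)-\frac{\tau^\gamma}{2}\sum_{k=0}^nl_k^\beta\,\nabla_h^\alpha\left(u(x_i,t_{n+1-k})+u(x_i,t_{n-k})\right)-\tau f(x_i,t_{n+\frac12})$$ satisfy $|R_i^{n+1}|\le C_u\,\tau(\tau^2+h^2)$ for all $1\le i\le M-1$, $0\le n\le N-1$. Then, with $e_i^n=u(x_i,t_n)-u_i^n$, $$\|e^n\|\le 2C_ub^{\frac12}T(\tau^2+h^2),\qquad n=0,1,\ldots,N.$$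
   Context: Grid: $b,T>0$, integers $M\ge 2$, $N\ge 1$, $h=b/M$, $\tau=T/N$, $x_i=ih$ ($0\le i\le M$), $t_n=n\tau$ ($0\le n\le N$), $t_{n+\frac12}=(n+\frac12)\tau$, $f_i^{n+\frac12}=f(x_i,t_{n+\frac12})$ for the given real source function $f$. Riesz fractional derivative on $(0,b)$, for $1<\alpha<2$: $\nabla_x^\alpha u(x,t)=-\kappa_\alpha\left({}_0D_x^\alpha+{}_xD_b^\alpha\right)u(x,t)$ with $\kappa_\alpha=\frac{1}{2\cos(\alpha\pi/2)}$, $${}_0D_x^\alpha u(x,t)=\frac{1}{\Gamma(2-\alpha)}\frac{\partial^2}{\partial x^2}\int_0^x(x-\xi)^{1-\alpha}u(\xi,t)\,d\xi,\qquad {}_xD_b^\alpha u(x,t)=\frac{1}{\Gamma(2-\alpha)}\frac{\partial^2}{\partial x^2}\int_x^b(\xi-x)^{1-\alpha}u(\xi,t)\,d\xi;$$ for $\alpha=2$, $\nabla_x^2=\partial^2/\partial x^2$. Discrete inner product and norm for grid functions: $(u^n,v^n)=h\sum_{i=1}^{M-1}u_i^nv_i^n$, $\|u^n\|=(u^n,u^n)^{1/2}$. Discrete Riesz derivative: for a grid function $v$ and $1\le i\le M-1$, $$\nabla_h^{\alpha}v_i=-\frac{\kappa_\alpha}{\Gamma(4-\alpha)h^\alpha}\sum_{j=1}^{M-1}w_{i,j}^{\alpha}v_j,$$ and $\nabla_h^\alpha u(x_i,t)$ means this operator applied to the grid values $v_j=u(x_j,t)$. Here $w_{i,j}^\alpha=w_{|i-j|+1}^\alpha$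 if $|i-j|\ge 2$, $w_{i,j}^\alpha=w_0^\alpha+w_2^\alpha$ if $|i-j|=1$, $w_{i,i}^\alpha=2w_1^\alpha$, and $w_0^\alpha=1$, $w_1^\alpha=-4+2^{3-\alpha}$, $w_2^\alpha=6-2^{5-\alpha}+3^{3-\alpha}$, and for $m\ge 3$ $$w_m^\alpha=(m+1)^{3-\alpha}-4m^{3-\alpha}+6(m-1)^{3-\alpha}-4(m-2)^{3-\alpha}+(m-3)^{3-\alpha}.$$ Coefficients $l_k^\beta$ ($k\ge 0$): the Taylor coefficients at $z=0$ in $$\left(1-\frac{z}{e^{\lambda\tau}}\right)^{-\beta}\left(1+\frac12\left(1-\frac{z}{e^{\lambda\tau}}\right)\right)^{-\beta}=\sum_{k=0}^\infty l_k^\beta z^k.$$ Equivalently $l_k^{\beta}=e^{-\lambda k\tau}\left(\frac32\right)^{-\beta}\sum_{m=0}^k3^{-m}g_m^{-\beta}g_{k-m}^{-\beta}$, where $(1-z)^{-\beta}=\sum_{m\ge0}g_m^{-\beta}z^m$. *)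

theory Defs
  imports "HOL-Analysis.Analysis"
begin

definition kappa :: "real \<Rightarrow> real" where
  "kappa \<alpha> = 1 / (2 * cos (\<alpha> * pi / 2))"

definition left_integrand :: "real \<Rightarrow> (real \<Rightarrow> real) \<Rightarrow> real \<Rightarrow> real \<Rightarrow> real" where
  "left_integrand \<alpha> v x \<xi> = (x - \<xi>) powr (1 - \<alpha>) * v \<xi>"

definition right_integrand :: "real \<Rightarrow> (real \<Rightarrow> real) \<Rightarrow> real \<Rightarrow> real \<Rightarrow> real" where
  "right_integrand \<alpha> v x \<xi> = (\<xi> - x) powr (1 - \<alpha>) * v \<xi>"

definition left_RL_deriv :: "real \<Rightarrow> (real \<Rightarrow> real) \<Rightarrow> real \<Rightarrow> real" where
  "left_RL_deriv \<alpha> v x =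
     1 / Gamma (2 - \<alpha>) * (deriv ^^ 2) (\<lambda>y. integral {0..y} (left_integrand \<alpha> v y)) x"

definition right_RL_deriv :: "real \<Rightarrow> real \<Rightarrow> (real \<Rightarrow> real) \<Rightarrow> real \<Rightarrow> real" where
  "right_RL_deriv b \<alpha> v x =
     1 / Gamma (2 - \<alpha>) * (deriv ^^ 2) (\<lambda>y. integral {y..b} (right_integrand \<alpha> v y)) x"

definition riesz_deriv :: "real \<Rightarrow> real \<Rightarrow> (real \<Rightarrow> real) \<Rightarrow> real \<Rightarrow> real" where
  "riesz_deriv b \<alpha> v x =
     (if \<alpha> = 2 then (deriv ^^ 2) v x
      else - kappa \<alpha> * (left_RL_deriv \<alpha> v x + right_RL_deriv b \<alpha> v x))"

definition twice_differentiable_at :: "(real \<Rightarrow> real) \<Rightarrow> real \<Rightarrow> bool" where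
  "twice_differentiable_at g x \<longleftrightarrow>
     (\<forall>\<^sub>F y in nhds x. g differentiable at y) \<and> deriv g differentiable at x"

text \<open>Since \<open>deriv\<close> and \<open>integral\<close> are total functions, the existence of the
  derivatives and integrals occurring in \<open>riesz_deriv\<close> is recorded separately.
  Absolute integrability makes \<open>integral\<close> the Lebesgue integral.\<close>

definition riesz_differentiable_at :: "real \<Rightarrow> real \<Rightarrow> (real \<Rightarrow> real) \<Rightarrow> real \<Rightarrow> bool" where
  "riesz_differentiable_at b \<alpha> v x \<longleftrightarrow>
     (if \<alpha> = 2 then twice_differentiable_at v x
      else (\<forall>\<^sub>F y in nhds x. left_integrand \<alpha> v y absolutely_integrable_on {0..y} \<and>
                            right_integrand \<alpha> v y absolutely_integrable_on {y..b}) \<and>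
           twice_differentiable_at (\<lambda>y. integral {0..y} (left_integrand \<alpha> v y)) x \<and>
           twice_differentiable_at (\<lambda>y. integral {y..b} (right_integrand \<alpha> v y)) x)"

definition memory_integrand ::
  "real \<Rightarrow> real \<Rightarrow> real \<Rightarrow> real \<Rightarrow> (real \<Rightarrow> real \<Rightarrow> real) \<Rightarrow> real \<Rightarrow> real \<Rightarrow> real \<Rightarrow> real" where
  "memory_integrand b \<alpha> \<gamma> lam u x t s =
     (t - s) powr (\<gamma> - 2) * exp (- lam * (t - s)) * riesz_deriv b \<alpha> (\<lambda>\<xi>. u \<xi> s) x"

text \<open>\<open>u x t\<close> is a pointwise solution on \<open>(0,b) \<times> (0,T]\<close>; the derivative with respect to
  \<open>t\<close> is two-sided for \<open>t < T\<close> and from the left at \<open>t = T\<close>.\<close>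

definition exact_solution ::
  "real \<Rightarrow> real \<Rightarrow> real \<Rightarrow> real \<Rightarrow> real \<Rightarrow> (real \<Rightarrow> real \<Rightarrow> real) \<Rightarrow> (real \<Rightarrow> real \<Rightarrow> real) \<Rightarrow> bool" where
  "exact_solution b T \<alpha> \<gamma> lam f u \<longleftrightarrow>
     (\<forall>x\<in>{0<..<b}. \<forall>t\<in>{0<..T}.
        riesz_differentiable_at b \<alpha> (\<lambda>\<xi>. u \<xi> t) x \<and>
        memory_integrand b \<alpha> \<gamma> lam u x t absolutely_integrable_on {0..t} \<and>
        ((\<lambda>s. u x s) has_real_derivative
           1 / Gamma (\<gamma> - 1) * integral {0..t} (memory_integrand b \<alpha> \<gamma> lam u x t) + f x t)
          (at t within {0..T})) \<and>
     (\<forall>x\<in>{0..b}. u x 0 = 0) \<and>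
     (\<forall>t\<in>{0..T}. u 0 t = 0 \<and> u b t = 0)"

text \<open>Grid functions are \<open>nat \<Rightarrow> real\<close>, read at indices \<open>0..M\<close>; space-time grid functions
  take the space index first.\<close>

definition grid_inner :: "real \<Rightarrow> nat \<Rightarrow> (nat \<Rightarrow> real) \<Rightarrow> (nat \<Rightarrow> real) \<Rightarrow> real" where
  "grid_inner h M v w = h * (\<Sum>i=1..M-1. v i * w i)"

definition grid_norm :: "real \<Rightarrow> nat \<Rightarrow> (nat \<Rightarrow> real) \<Rightarrow> real" where
  "grid_norm h M v = sqrt (grid_inner h M v v)"

definition weight :: "real \<Rightarrow> nat \<Rightarrow> real" where
  "weight \<alpha> m =
     (if m = 0 then 1
      else if m = 1 then - 4 + 2 powr (3 - \<alpha>)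
      else if m = 2 then 6 - 2 powr (5 - \<alpha>) + 3 powr (3 - \<alpha>)
      else (real m + 1) powr (3 - \<alpha>) - 4 * real m powr (3 - \<alpha>)
           + 6 * (real m - 1) powr (3 - \<alpha>) - 4 * (real m - 2) powr (3 - \<alpha>)
           + (real m - 3) powr (3 - \<alpha>))"

definition weight2 :: "real \<Rightarrow> nat \<Rightarrow> nat \<Rightarrow> real" where
  "weight2 \<alpha> i j =
     (let d = nat \<bar>int i - int j\<bar> in
      if d = 0 then 2 * weight \<alpha> 1
      else if d = 1 then weight \<alpha> 0 + weight \<alpha> 2
      else weight \<alpha> (d + 1))"

definition discrete_riesz :: "real \<Rightarrow> real \<Rightarrow> nat \<Rightarrow> (nat \<Rightarrow> real) \<Rightarrow> nat \<Rightarrow> real" where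
  "discrete_riesz \<alpha> h M v i =
     - kappa \<alpha> / (Gamma (4 - \<alpha>) * h powr \<alpha>) * (\<Sum>j=1..M-1. weight2 \<alpha> i j * v j)"

definition generating_function :: "real \<Rightarrow> real \<Rightarrow> real \<Rightarrow> real \<Rightarrow> real" where
  "generating_function \<beta> lam \<tau> z =
     (1 - z / exp (lam * \<tau>)) powr (- \<beta>) * (1 + 1/2 * (1 - z / exp (lam * \<tau>))) powr (- \<beta>)"

definition lcoeff :: "real \<Rightarrow> real \<Rightarrow> real \<Rightarrow> nat \<Rightarrow> real" where
  "lcoeff \<beta> lam \<tau> k = (deriv ^^ k) (generating_function \<beta> lam \<tau>) 0 / fact k"

definition scheme_solution ::
  "real \<Rightarrow> real \<Rightarrow> real \<Rightarrow> real \<Rightarrow> real \<Rightarrow> nat \<Rightarrow> nat \<Rightarrow> (real \<Rightarrow> real \<Rightarrow> real) \<Rightarrow>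
   (nat \<Rightarrow> nat \<Rightarrow> real) \<Rightarrow> bool" where
  "scheme_solution \<alpha> \<gamma> lam h \<tau> M N f U \<longleftrightarrow>
     (\<forall>i\<in>{1..M-1}. \<forall>n<N.
        U i (n + 1) - U i n =
          \<tau> powr \<gamma> / 2 * (\<Sum>k=0..n. lcoeff (\<gamma> - 1) lam \<tau> k *
             discrete_riesz \<alpha> h M (\<lambda>j. U j (n + 1 - k) + U j (n - k)) i)
          + \<tau> * f (real i * h) ((real n + 1/2) * \<tau>)) \<and>
     (\<forall>i\<le>M. U i 0 = 0) \<and>
     (\<forall>n\<le>N. U 0 n = 0 \<and> U M n = 0)"

text \<open>\<open>residual \<dots> i n\<close> is the residual with upper time index \<open>n + 1\<close>.\<close>

definition residual ::
  "real \<Rightarrow> real \<Rightarrow> real \<Rightarrow> real \<Rightarrow> real \<Rightarrow> nat \<Rightarrow> (real \<Rightarrow> real \<Rightarrow> real) \<Rightarrow>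
   (real \<Rightarrow> real \<Rightarrow> real) \<Rightarrow> nat \<Rightarrow> nat \<Rightarrow> real" where
  "residual \<alpha> \<gamma> lam h \<tau> M f u i n =
     u (real i * h) (real (n + 1) * \<tau>) - u (real i * h) (real n * \<tau>)
     - \<tau> powr \<gamma> / 2 * (\<Sum>k=0..n. lcoeff (\<gamma> - 1) lam \<tau> k *
         discrete_riesz \<alpha> h M
           (\<lambda>j. u (real j * h) (real (n + 1 - k) * \<tau>) + u (real j * h) (real (n - k) * \<tau>)) i)
     - \<tau> * f (real i * h) ((real n + 1/2) * \<tau>)"

end

theory Submission imports Defs "HOL-Complex_Analysis.Complex_Analysis" begin

text \<open>
  Subtracting the scheme from the definition of the residual shows that the error \<open>e\<close> solves
  the same difference scheme as \<open>u\<close>, with zero initial value and with the residual as its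
  source.  The theorem is therefore an energy estimate for the scheme.  Test the error equation
  with \<open>v\<^sup>n = e\<^sup>n\<^sup>+\<^sup>1 + e\<^sup>n\<close> and sum over the time levels: the left-hand side
  telescopes to the squared norm of the last error, the memory term is a quadratic form of
  convolution type, and once that form is known to be nonpositive, Cauchy-Schwarz for the source
  gives \<open>E\<^sup>2 \<le> N \<rho> sqrt b 2 E\<close> for the largest error norm \<open>E\<close> and a bound
  \<open>\<rho>\<close> of the residual.

  The sign of the memory term rests on two positivity facts.

  In space, the matrix \<open>weight2\<close> is the fourth central difference of
  \<open>\<bar>x\<bar> powr (3 - \<alpha>)\<close> on the integers.  The mean value theorem, applied once for each
  difference, reads off the signs of the differences of a power, so that off-diagonal entries are
  nonnegative and row sums, which telescope to a third difference, are nonpositive.  Such a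
  symmetric matrix is negative semidefinite (\<open>weight2_negative_semidefinite\<close>).

  In time, the generating function of the coefficients \<open>l\<^sub>k\<close> is
  \<open>((1 - w) (3 - w) / 2) powr (- \<beta>)\<close> with \<open>w = exp (- \<lambda> \<tau>) z\<close>.  In the unit disc
  \<open>(1 - w) (3 - w)\<close> has positive real part (this is the A-stability of the two-step backward
  difference formula), and raising to a power \<open>- \<beta>\<close> with \<open>0 \<le> \<beta> \<le> 1\<close> keeps the
  argument within \<open>\<pi> / 2\<close> (\<open>Re_complex_generating_function_nonneg\<close>).

  The two facts are combined in \<open>convolution_form_nonneg\<close>: if the cosine series of \<open>l\<close> is
  nonnegative and \<open>G\<close> is a positive semidefinite kernel, then the sum of
  \<open>l\<^sub>k G(n-k, n)\<close> is nonnegative.  It is the integral over a period of the cosine series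
  against a nonnegative trigonometric polynomial, a Schur product argument that treats
  space and time together.
\<close>

section \<open>Signs of the finite differences of powers\<close>

text \<open>
  The forward difference of order \<open>k\<close> with unit step of \<open>\<lambda>x. x powr p\<close>, in recursive form
  because each use of the mean value theorem removes one difference.
\<close>

primrec fwd_diff :: "nat \<Rightarrow> real \<Rightarrow> real \<Rightarrow> real" where
  "fwd_diff 0 p x = x powr p"
| "fwd_diff (Suc k) p x = fwd_diff k p (x + 1) - fwd_diff k p x"

lemma fwd_diff_0_eq: "fwd_diff 0 p = (\<lambda>x. x powr p)"
  and fwd_diff_Suc_eq: "fwd_diff (Suc k) p = (\<lambda>x. fwd_diff k p (x + 1) - fwd_diff k p x)"
  by (simp_all add: fun_eq_iff)

lemma fwd_diff_numeral:
  "fwd_diff (numeral k) p x = fwd_diff (pred_numeral k) p (x + 1) - fwd_diff (pred_numeral k) p x"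
  by (simp add: numeral_eq_Suc)

lemma fwd_diff_has_real_derivative:
  "x > 0 \<Longrightarrow> (fwd_diff k p has_real_derivative p * fwd_diff k (p - 1) x) (at x)"
proof (induction k arbitrary: x)
  case 0
  then show ?case
    unfolding fwd_diff_0_eq by (rule has_real_derivative_powr)
next
  case (Suc k)
  have "((\<lambda>x. fwd_diff k p (x + 1)) has_real_derivative p * fwd_diff k (p - 1) (x + 1)) (at x)"
    using Suc.IH[of "x + 1"] Suc.prems DERIV_shift[of "fwd_diff k p" _ x 1] by simp
  from DERIV_diff[OF this Suc.IH[OF Suc.prems]] show ?case
    unfolding fwd_diff_Suc_eq by (simp add: algebra_simps)
qed

lemma fwd_diff_continuous_on:
  "p > 0 \<Longrightarrow> continuous_on {0..} (fwd_diff k p)"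
proof (induction k)
  case 0
  then show ?case
    unfolding fwd_diff_0_eq by (intro continuous_on_powr' continuous_intros) auto
next
  case (Suc k)
  have "continuous_on {0..} (\<lambda>x. fwd_diff k p (x + 1))"
    by (rule continuous_on_compose2[OF Suc.IH[OF Suc.prems]]) (auto intro!: continuous_intros)
  then show ?case
    unfolding fwd_diff_Suc_eq by (intro continuous_on_diff Suc.IH[OF Suc.prems])
qed

text \<open>
  A difference of order \<open>k\<close> is a value of the \<open>k\<close>-th derivative at an intermediate point:
  differencing and differentiation commute, so the mean value theorem trades one difference for
  one derivative.
\<close>

lemma fwd_diff_mean_value:
  "x > 0 \<Longrightarrow> \<exists>\<xi>>0. fwd_diff k p x = (\<Prod>i<k. p - real i) * \<xi> powr (p - real k)"
proof (induction k arbitrary: p x)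
  case 0
  then show ?case by auto
next
  case (Suc k)
  have "\<exists>z. x < z \<and> z < x + 1 \<and>
      fwd_diff k p (x + 1) - fwd_diff k p x = (x + 1 - x) * (p * fwd_diff k (p - 1) z)"
    by (rule MVT2) (use Suc.prems in \<open>auto intro!: fwd_diff_has_real_derivative\<close>)
  then obtain z where z: "x < z" "fwd_diff (Suc k) p x = p * fwd_diff k (p - 1) z"
    by auto
  obtain \<xi> where "\<xi> > 0" "fwd_diff k (p - 1) z = (\<Prod>i<k. p - 1 - real i) * \<xi> powr (p - 1 - real k)"
    using Suc.IH[of z "p - 1"] z Suc.prems by auto
  moreover have "p * (\<Prod>i<k. p - 1 - real i) = (\<Prod>i<Suc k. p - real i)"
    by (simp only: prod.lessThan_Suc_shift) (simp add: algebra_simps)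
  moreover have "p - 1 - real k = p - real (Suc k)"
    by simp
  ultimately show ?case
    using z by (metis mult.assoc)
qed

text \<open>
  For \<open>p > 0\<close> the power is continuous at \<open>0\<close>, and the intermediate point of the first mean
  value step is positive; this admits the left end point \<open>x = 0\<close>, which the stencil of the
  scheme reaches.
\<close>

lemma fwd_diff_mean_value_0:
  assumes "x \<ge> 0" "p > 0"
  shows "\<exists>\<xi>>0. fwd_diff (Suc k) p x = (\<Prod>i<Suc k. p - real i) * \<xi> powr (p - real (Suc k))"
proof -
  have "\<exists>l z. x < z \<and> z < x + 1 \<and> (fwd_diff k p has_real_derivative l) (at z) \<and>
      fwd_diff k p (x + 1) - fwd_diff k p x = (x + 1 - x) * l"
  proof (rule MVT)
    show "continuous_on {x..x + 1} (fwd_diff k p)"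
      by (rule continuous_on_subset[OF fwd_diff_continuous_on]) (use assms in auto)
    show "fwd_diff k p differentiable (at z)" if "x < z" "z < x + 1" for z
      using fwd_diff_has_real_derivative[of z k p] that assms
      by (auto simp: real_differentiable_def)
  qed auto
  then obtain l z where z: "x < z" "(fwd_diff k p has_real_derivative l) (at z)"
    "fwd_diff (Suc k) p x = l" by auto
  have "l = p * fwd_diff k (p - 1) z"
    using fwd_diff_has_real_derivative[of z k p] z assms by (auto intro: DERIV_unique)
  moreover obtain \<xi> where "\<xi> > 0"
    "fwd_diff k (p - 1) z = (\<Prod>i<k. p - 1 - real i) * \<xi> powr (p - 1 - real k)"
    using fwd_diff_mean_value[of z k "p - 1"] z assms by auto
  moreover have "p * (\<Prod>i<k. p - 1 - real i) = (\<Prod>i<Suc k. p - real i)"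
    by (simp only: prod.lessThan_Suc_shift) (simp add: algebra_simps)
  moreover have "p - 1 - real k = p - real (Suc k)"
    by simp
  ultimately show ?thesis
    using z by (metis mult.assoc)
qed

lemma third_diff_nonpos:
  assumes "x \<ge> 0" "1 \<le> s" "s \<le> 2"
  shows "fwd_diff 3 s x \<le> 0"
proof -
  obtain \<xi> where "fwd_diff 3 s x = (\<Prod>i<3. s - real i) * \<xi> powr (s - 3)"
    using fwd_diff_mean_value_0[of x s 2] assms by auto
  moreover have "(\<Prod>i<3. s - real i) = s * (s - 1) * (s - 2)"
    by (simp add: lessThan_nat_numeral lessThan_Suc)
  moreover have "s * (s - 1) * (s - 2) \<le> 0"
    using assms by (intro mult_nonneg_nonpos mult_nonneg_nonneg) auto
  ultimately show ?thesis
    by (simp add: mult_nonpos_nonneg)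
qed

lemma fourth_diff_nonneg:
  assumes "x \<ge> 0" "1 \<le> s" "s \<le> 2"
  shows "fwd_diff 4 s x \<ge> 0"
proof -
  obtain \<xi> where "fwd_diff 4 s x = (\<Prod>i<4. s - real i) * \<xi> powr (s - 4)"
    using fwd_diff_mean_value_0[of x s 3] assms by auto
  moreover have "(\<Prod>i<4. s - real i) = s * (s - 1) * ((2 - s) * (3 - s))"
    by (simp add: lessThan_nat_numeral lessThan_Suc algebra_simps)
  moreover have "0 \<le> s * (s - 1) * ((2 - s) * (3 - s))"
    using assms by (intro mult_nonneg_nonneg) auto
  ultimately show ?thesis
    by simp
qed

text \<open>
  The central difference of \<open>\<bar>x\<bar> powr s\<close> at \<open>1\<close> straddles the kink at \<open>0\<close>, where the
  derivative formula says nothing.  With \<open>z = 2 powr (s - 2)\<close> and \<open>y = 3 powr (s - 2)\<close> the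
  claim reads \<open>16 z \<le> 9 y + 7\<close>.  At \<open>s = 2\<close> equality holds, which dictates the weights
  \<open>9/16\<close> and \<open>7/16\<close> in Young's inequality; it then remains to see
  \<open>z \<le> y powr (9/16)\<close>, that is \<open>3\<^sup>9 \<le> 2\<^sup>1\<^sup>6\<close>.
\<close>

lemma central_fourth_diff_at_1_nonneg:
  fixes s :: real
  assumes "s \<le> 2"
  shows "3 powr s - 4 * 2 powr s + 7 \<ge> 0"
proof -
  define z :: real where "z = 2 powr (s - 2)"
  define y :: real where "y = 3 powr (s - 2)"
  have pos: "z > 0" "y > 0" by (auto simp: z_def y_def)
  have "z \<le> y powr (9/16)"
  proof -
    have "ln (3 ^ 9 :: real) \<le> ln (2 ^ 16)"
      by simp
    then have "9 * ln 3 \<le> 16 * ln (2::real)"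
      by (simp only: ln_realpow)
    then have "(2 - s) * (9 * ln 3) \<le> (2 - s) * (16 * ln 2)"
      using assms by (intro mult_left_mono) auto
    then show ?thesis
      by (simp add: z_def y_def powr_def algebra_simps)
  qed
  also have "\<dots> \<le> 9/16 * y + 7/16"
    using Youngs_inequality_0[of "9/16" "7/16" y 1] pos by simp
  finally have "16 * z \<le> 9 * y + 7" by simp
  moreover have "2 powr s = 4 * z" "3 powr s = 9 * y"
    by (simp_all add: z_def y_def powr_diff)
  ultimately show ?thesis by simp
qed

section \<open>Dissipativity of the discrete Riesz derivative\<close>

text \<open>
  The matrix \<open>weight2\<close> as a function of the distance from the diagonal.
\<close>

definition stencil :: "real \<Rightarrow> nat \<Rightarrow> real" where
  "stencil \<alpha> d = (if d = 0 then 2 * weight \<alpha> 1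
      else if d = 1 then weight \<alpha> 0 + weight \<alpha> 2 else weight \<alpha> (d + 1))"

lemma weight2_eq_stencil: "weight2 \<alpha> i j = stencil \<alpha> (nat \<bar>int i - int j\<bar>)"
  by (simp add: weight2_def stencil_def Let_def)

lemma two_powr_5: "(2::real) powr (5 - \<alpha>) = 4 * 2 powr (3 - \<alpha>)"
proof -
  have "(2::real) powr (5 - \<alpha>) = 2 powr (2 + (3 - \<alpha>))"
    by simp
  also have "\<dots> = 2 powr 2 * 2 powr (3 - \<alpha>)"
    by (rule powr_add)
  finally show ?thesis by simp
qed

lemma stencil_eq_fourth_diff: "stencil \<alpha> (d + 2) = fwd_diff 4 (3 - \<alpha>) (real d)"
proof -
  have "fwd_diff 4 p x = (x + 4) powr p - 4 * (x + 3) powr p + 6 * (x + 2) powr p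
      - 4 * (x + 1) powr p + x powr p" for p x
    by (simp add: fwd_diff_numeral algebra_simps)
  moreover have "real (d + 3) - 3 = real d" "real (d + 3) - 2 = real d + 1"
    "real (d + 3) - 1 = real d + 2" "real (d + 3) + 1 = real d + 4" "real (d + 3) = real d + 3"
    by simp_all
  ultimately show ?thesis
    by (simp add: stencil_def weight_def add.commute)
qed

lemma stencil_nonneg:
  assumes "1 < \<alpha>" "\<alpha> \<le> 2" "d \<ge> 1"
  shows "stencil \<alpha> d \<ge> 0"
proof (cases "d = 1")
  case True
  then show ?thesis
    using central_fourth_diff_at_1_nonneg[of "3 - \<alpha>"] assms two_powr_5
    by (simp add: stencil_def weight_def)
next
  case False
  then obtain e where "d = e + 2"
    using assms by (metis add.commute le_Suc_ex One_nat_def le_neq_implies_less less_eq_Suc_le numeral_2_eq_2)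
  then show ?thesis
    using fourth_diff_nonneg[of "real e" "3 - \<alpha>"] assms
    unfolding \<open>d = e + 2\<close> stencil_eq_fourth_diff by simp
qed

text \<open>
  The sum over the symmetric window \<open>- D - 1, \<dots>, D + 1\<close> of a fourth difference telescopes at
  both ends to a third difference.
\<close>

lemma stencil_partial_sum:
  "stencil \<alpha> 0 + 2 * (\<Sum>d=1..Suc D. stencil \<alpha> d) = 2 * fwd_diff 3 (3 - \<alpha>) (real D)"
proof (induction D)
  case 0
  then show ?case
    using two_powr_5[of \<alpha>] by (simp add: stencil_def weight_def fwd_diff_numeral)
next
  case (Suc D)
  have "stencil \<alpha> (Suc (Suc D)) = fwd_diff 3 (3 - \<alpha>) (real (Suc D)) - fwd_diff 3 (3 - \<alpha>) (real D)"
    using stencil_eq_fourth_diff[of \<alpha> D] by (simp add: fwd_diff_numeral[of "num.Bit0 _"] add.commute)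
  with Suc show ?case by simp
qed

lemma stencil_half_sum_nonpos:
  assumes "1 < \<alpha>" "\<alpha> \<le> 2"
  shows "stencil \<alpha> 0 + 2 * (\<Sum>d=1..D. stencil \<alpha> d) \<le> 0"
proof (cases D)
  case 0
  have "(2::real) powr (3 - \<alpha>) \<le> 2 powr 2"
    using assms by (intro powr_mono) auto
  then show ?thesis
    using 0 by (simp add: stencil_def weight_def)
next
  case (Suc n)
  then show ?thesis
    using third_diff_nonpos[of "real n" "3 - \<alpha>"] assms
    unfolding \<open>D = Suc n\<close> stencil_partial_sum by simp
qed

text \<open>
  A row splits at the diagonal into two one-sided sums of possibly different lengths.  Half of the
  diagonal entry compensates each of them.
\<close>

lemma weight2_row_sum_nonpos:
  assumes "1 < \<alpha>" "\<alpha> \<le> 2" "i \<in> {1..n}"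
  shows "(\<Sum>j=1..n. weight2 \<alpha> i j) \<le> 0"
proof -
  have "{1..n} = {1..<i} \<union> ({i} \<union> {i<..n})"
    using assms by auto
  then have "(\<Sum>j=1..n. weight2 \<alpha> i j) = (\<Sum>j\<in>{1..<i} \<union> ({i} \<union> {i<..n}). weight2 \<alpha> i j)"
    by simp
  also have "\<dots> =
      (\<Sum>j\<in>{1..<i}. weight2 \<alpha> i j) + (weight2 \<alpha> i i + (\<Sum>j\<in>{i<..n}. weight2 \<alpha> i j))"
    by (subst sum.union_disjoint; auto)
  also have "(\<Sum>j\<in>{1..<i}. weight2 \<alpha> i j) = (\<Sum>d=1..i-1. stencil \<alpha> d)"
    by (rule sum.reindex_bij_witness[where i = "\<lambda>d. i - d" and j = "\<lambda>j. i - j"])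
       (auto simp: weight2_eq_stencil nat_diff_distrib)
  also have "(\<Sum>j\<in>{i<..n}. weight2 \<alpha> i j) = (\<Sum>d=1..n-i. stencil \<alpha> d)"
    by (rule sum.reindex_bij_witness[where i = "\<lambda>d. i + d" and j = "\<lambda>j. j - i"])
       (auto simp: weight2_eq_stencil nat_diff_distrib abs_if)
  finally show ?thesis
    using stencil_half_sum_nonpos[OF assms(1,2), of "i - 1"]
      stencil_half_sum_nonpos[OF assms(1,2), of "n - i"]
    by (simp add: weight2_eq_stencil)
qed

text \<open>
  Write \<open>v i * v j\<close> as \<open>((v i)\<^sup>2 + (v j)\<^sup>2 - (v i - v j)\<^sup>2) / 2\<close>.  The squares collect the row
  sums, and the last square drops the diagonal.
\<close>

lemma diagonally_dominant_nonpos: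
  fixes a :: "'i \<Rightarrow> 'i \<Rightarrow> real"
  assumes sym: "\<And>i j. a i j = a j i"
    and offdiag: "\<And>i j. i \<in> I \<Longrightarrow> j \<in> I \<Longrightarrow> i \<noteq> j \<Longrightarrow> a i j \<ge> 0"
    and row: "\<And>i. i \<in> I \<Longrightarrow> (\<Sum>j\<in>I. a i j) \<le> 0"
  shows "(\<Sum>i\<in>I. \<Sum>j\<in>I. a i j * v i * v j) \<le> 0"
proof -
  have "(\<Sum>i\<in>I. \<Sum>j\<in>I. a i j * v i * v j) \<le>
      (\<Sum>i\<in>I. \<Sum>j\<in>I. (v i)\<^sup>2 / 2 * a i j + (v j)\<^sup>2 / 2 * a i j)"
  proof (intro sum_mono)
    fix i j assume "i \<in> I" "j \<in> I"
    then have "0 \<le> a i j * (v i - v j)\<^sup>2"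
      using offdiag[of i j] by (cases "i = j") auto
    then show "a i j * v i * v j \<le> (v i)\<^sup>2 / 2 * a i j + (v j)\<^sup>2 / 2 * a i j"
      by (simp add: power2_eq_square algebra_simps)
  qed
  also have "\<dots> = (\<Sum>i\<in>I. \<Sum>j\<in>I. (v i)\<^sup>2 / 2 * a i j) + (\<Sum>j\<in>I. \<Sum>i\<in>I. (v j)\<^sup>2 / 2 * a i j)"
    unfolding sum.distrib by (rule arg_cong2[where f = "(+)", OF refl sum.swap])
  also have "(\<Sum>j\<in>I. \<Sum>i\<in>I. (v j)\<^sup>2 / 2 * a i j) = (\<Sum>i\<in>I. \<Sum>j\<in>I. (v i)\<^sup>2 / 2 * a i j)"
    by (subst sym) (rule refl)
  also have "(\<Sum>i\<in>I. \<Sum>j\<in>I. (v i)\<^sup>2 / 2 * a i j) + (\<Sum>i\<in>I. \<Sum>j\<in>I. (v i)\<^sup>2 / 2 * a i j) =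
      (\<Sum>i\<in>I. (v i)\<^sup>2 * (\<Sum>j\<in>I. a i j))"
    unfolding sum_distrib_left sum.distrib[symmetric] by (simp add: mult.commute)
  also have "\<dots> \<le> 0"
    by (intro sum_nonpos mult_nonneg_nonpos row) auto
  finally show ?thesis .
qed

lemma weight2_sym: "weight2 \<alpha> i j = weight2 \<alpha> j i"
  by (simp add: weight2_eq_stencil abs_minus_commute)

lemma weight2_negative_semidefinite:
  assumes "1 < \<alpha>" "\<alpha> \<le> 2"
  shows "(\<Sum>i=1..n. \<Sum>j=1..n. weight2 \<alpha> i j * v i * v j) \<le> 0"
proof (rule diagonally_dominant_nonpos)
  show "weight2 \<alpha> i j \<ge> 0" if "i \<noteq> j" for i j
    unfolding weight2_eq_stencil using that by (intro stencil_nonneg assms) auto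
qed (use assms weight2_row_sum_nonpos weight2_sym in auto)

lemma kappa_neg:
  assumes "1 < \<alpha>" "\<alpha> \<le> 2"
  shows "kappa \<alpha> < 0"
proof -
  have "cos (\<alpha> * pi / 2) < 0"
  proof -
    have "0 < cos (pi - \<alpha> * pi / 2)"
      by (rule cos_gt_zero_pi) (use assms pi_gt_zero in \<open>auto simp: field_simps\<close>)
    then show ?thesis by (simp add: cos_diff)
  qed
  then show ?thesis by (simp add: kappa_def divide_less_0_iff)
qed

lemma grid_inner_discrete_riesz:
  "grid_inner h M (discrete_riesz \<alpha> h M v) w =
     - h * kappa \<alpha> / (Gamma (4 - \<alpha>) * h powr \<alpha>) *
       (\<Sum>i=1..M-1. \<Sum>j=1..M-1. weight2 \<alpha> i j * w i * v j)"
  by (simp add: grid_inner_def discrete_riesz_def sum_distrib_left sum_distrib_right mult_ac)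

lemma discrete_riesz_symmetric:
  "grid_inner h M (discrete_riesz \<alpha> h M v) w = grid_inner h M (discrete_riesz \<alpha> h M w) v"
proof -
  have "(\<Sum>i=1..M-1. \<Sum>j=1..M-1. weight2 \<alpha> i j * w i * v j) =
      (\<Sum>i=1..M-1. \<Sum>j=1..M-1. weight2 \<alpha> i j * v i * w j)"
    by (subst sum.swap) (simp add: weight2_sym mult_ac)
  then show ?thesis by (simp only: grid_inner_discrete_riesz)
qed

lemma discrete_riesz_dissipative:
  assumes "1 < \<alpha>" "\<alpha> \<le> 2" "h > 0"
  shows "grid_inner h M (discrete_riesz \<alpha> h M v) v \<le> 0"
proof -
  have "Gamma (4 - \<alpha>) > 0"
    using assms by (intro Gamma_real_pos) auto
  then have "0 \<le> - h * kappa \<alpha> / (Gamma (4 - \<alpha>) * h powr \<alpha>)"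
    using kappa_neg[OF assms(1,2)] assms(3)
    by (intro divide_nonneg_nonneg) (auto simp: mult_nonneg_nonpos mult_nonneg_nonneg)
  then show ?thesis
    unfolding grid_inner_discrete_riesz
    using weight2_negative_semidefinite[OF assms(1,2)] by (intro mult_nonneg_nonpos) auto
qed

section \<open>Taylor coefficients of the generating function\<close>

lemma has_fps_expansion_imp_derivs:
  fixes f :: "real \<Rightarrow> real"
  assumes "f has_fps_expansion F"
  shows "(deriv ^^ k) f 0 / fact k = fps_nth F k"
proof -
  have "(deriv ^^ k) f 0 = fact k * fps_nth F k"
    using assms
  proof (induction k arbitrary: f F)
    case 0
    then show ?case by (simp add: has_fps_expansion_imp_0_eq_fps_nth_0)
  next
    case (Suc k)
    show ?case
      using Suc.IH[OF has_fps_expansion_deriv[OF Suc.prems]]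
      by (simp del: funpow.simps add: funpow_Suc_right)
  qed
  then show ?thesis by simp
qed

text \<open>
  This links the real derivatives in \<open>lcoeff\<close> to complex analysis.  On the real axis the real
  and imaginary parts of the complex Taylor series are real power series of \<open>g\<close> and of \<open>0\<close>,
  and a real power series determines its coefficients.
\<close>

lemma taylor_coeff_of_real_restriction:
  fixes g :: "real \<Rightarrow> real"
  assumes hol: "F holomorphic_on ball 0 1"
    and real: "\<And>x. \<bar>x\<bar> < 1 \<Longrightarrow> F (complex_of_real x) = complex_of_real (g x)"
  shows "(deriv ^^ k) F 0 / fact k = complex_of_real ((deriv ^^ k) g 0 / fact k)"
proof -
  define c where "c k = (deriv ^^ k) F 0 / fact k" for k
  have sums: "(\<lambda>k. c k * complex_of_real x ^ k) sums complex_of_real (g x)" if "\<bar>x\<bar> < 1" for x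
    using holomorphic_power_series[OF hol, of "of_real x"] real[of x] that by (simp add: c_def)
  have near_0: "eventually (\<lambda>x::real. \<bar>x\<bar> < 1) (nhds 0)"
    by (rule eventually_nhds_in_open[of "{x. \<bar>x\<bar> < 1}", simplified])
       (auto intro!: open_Collect_less continuous_intros)
  have "g has_fps_expansion Abs_fps (\<lambda>k. Re (c k))"
  proof (rule has_fps_expansionI, rule eventually_mono[OF near_0])
    fix x :: real assume "\<bar>x\<bar> < 1"
    from sums_Re[OF sums[OF this]] show "(\<lambda>n. fps_nth (Abs_fps (\<lambda>k. Re (c k))) n * x ^ n) sums g x"
      by (simp flip: of_real_power)
  qed
  moreover have "(\<lambda>_. 0) has_fps_expansion Abs_fps (\<lambda>k. Im (c k))"
  proof (rule has_fps_expansionI, rule eventually_mono[OF near_0])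
    fix x :: real assume "\<bar>x\<bar> < 1"
    from sums_Im[OF sums[OF this]] show "(\<lambda>n. fps_nth (Abs_fps (\<lambda>k. Im (c k))) n * x ^ n) sums 0"
      by (simp flip: of_real_power)
  qed
  moreover have "(deriv ^^ k) (\<lambda>_. 0 :: real) 0 = 0"
  proof -
    have "(deriv ^^ k) (\<lambda>_. 0 :: real) = (\<lambda>_. 0)"
      by (induction k) auto
    then show ?thesis by simp
  qed
  ultimately have "Re (c k) = (deriv ^^ k) g 0 / fact k" "Im (c k) = 0"
    using has_fps_expansion_imp_derivs[of g _ k]
      has_fps_expansion_imp_derivs[of "\<lambda>_. 0" "Abs_fps (\<lambda>k. Im (c k))" k] by auto
  then show ?thesis
    unfolding c_def[symmetric] by (simp only: complex_eq_iff Re_complex_of_real Im_complex_of_real)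
qed

text \<open>
  The analytic extension of \<open>generating_function\<close> to the unit disc, with \<open>q\<close> in the place of
  the damping factor \<open>exp (- lam * \<tau>)\<close>.
\<close>

definition complex_generating_function :: "real \<Rightarrow> real \<Rightarrow> complex \<Rightarrow> complex" where
  "complex_generating_function \<beta> q z =
     (1 - of_real q * z) powr of_real (- \<beta>) * (1 + 1/2 * (1 - of_real q * z)) powr of_real (- \<beta>)"

text \<open>
  The third inequality is the A-stability of the two-step backward difference formula: with
  \<open>w = x + i y\<close> the real part is \<open>(1 - x)\<^sup>2 + (1 - \<bar>w\<bar>\<^sup>2) / 2\<close>.  The first two keep the factors
  away from the branch cut of the logarithm.
\<close>

lemma unit_disc_real_parts:
  assumes "norm (w :: complex) < 1"
  shows "Re (1 - w) > 0" "Re (1 + 1/2 * (1 - w)) > 0" "Re ((1 - w) * (1 + 1/2 * (1 - w))) > 0"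
proof -
  have lt: "Re w < 1"
    using complex_Re_le_cmod[of w] assms by linarith
  then show "Re (1 - w) > 0" "Re (1 + 1/2 * (1 - w)) > 0"
    by (simp_all add: add_pos_pos)
  have "(Re w)\<^sup>2 + (Im w)\<^sup>2 < 1"
    using assms power_strict_mono[of "norm w" 1 2] by (simp add: cmod_power2)
  moreover have "Re ((1 - w) * (1 + 1/2 * (1 - w))) =
      (1 - Re w)\<^sup>2 + (1 - ((Re w)\<^sup>2 + (Im w)\<^sup>2)) / 2"
    by (simp add: power2_eq_square field_simps)
  ultimately show "Re ((1 - w) * (1 + 1/2 * (1 - w))) > 0"
    by (smt (verit) zero_le_power2 divide_pos_pos)
qed

lemma norm_mult_less_1:
  assumes "0 \<le> q" "q \<le> 1" "norm (z :: complex) < 1"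
  shows "norm (of_real q * z) < 1"
  using assms mult_left_le_one_le[of "norm z" q] by (simp add: norm_mult)

lemma complex_generating_function_holomorphic:
  assumes "0 \<le> q" "q \<le> 1"
  shows "complex_generating_function \<beta> q holomorphic_on ball 0 1"
  unfolding complex_generating_function_def
  using unit_disc_real_parts(1,2)[OF norm_mult_less_1[OF assms]]
  by (intro holomorphic_intros) (force simp: complex_nonpos_Reals_iff)+

text \<open>
  Both factors lie in the right half plane, so their logarithms add up to the logarithm of the
  product.  The product lies in the right half plane too, and an exponent of modulus at most \<open>1\<close>
  cannot turn it out of there.
\<close>

lemma Re_complex_generating_function_nonneg:
  assumes "0 \<le> q" "q \<le> 1" "0 \<le> \<beta>" "\<beta> \<le> 1" "norm z < 1"
  shows "Re (complex_generating_function \<beta> q z) \<ge> 0"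
proof -
  define A where "A = 1 - of_real q * z"
  define B where "B = 1 + 1/2 * A"
  have re: "Re A > 0" "Re B > 0" "Re (A * B) > 0"
    unfolding A_def B_def
    by (rule unit_disc_real_parts norm_mult_less_1 assms)+
  then have nz: "A \<noteq> 0" "B \<noteq> 0" by auto
  \<comment> \<open>Two arguments below \<open>pi / 2\<close> have a sum below \<open>pi\<close>: the principal branch is additive here.\<close>
  have "\<bar>Im (Ln A)\<bar> < pi / 2" "\<bar>Im (Ln B)\<bar> < pi / 2"
    using re Re_Ln_pos_lt_imp by auto
  then have "Ln (A * B) = Ln A + Ln B"
    by (intro Ln_times_simple) (use nz in \<open>auto simp: abs_less_iff\<close>)
  then have "complex_generating_function \<beta> q z = exp (- of_real \<beta> * Ln (A * B))"
    using nz unfolding complex_generating_function_def A_def[symmetric] B_def[symmetric]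
    by (simp add: powr_def exp_add[symmetric] algebra_simps)
  then have "Re (complex_generating_function \<beta> q z) =
      exp (- \<beta> * Re (Ln (A * B))) * cos (\<beta> * Im (Ln (A * B)))"
    by (simp add: Re_exp)
  moreover have "\<bar>\<beta> * Im (Ln (A * B))\<bar> \<le> pi / 2"
  proof -
    have "\<beta> * \<bar>Im (Ln (A * B))\<bar> \<le> 1 * (pi / 2)"
      using assms Re_Ln_pos_lt_imp[OF re(3)] by (intro mult_mono) auto
    then show ?thesis using assms by (simp add: abs_mult)
  qed
  then have "cos (\<beta> * Im (Ln (A * B))) \<ge> 0"
    by (intro cos_ge_zero) auto
  ultimately show ?thesis by simp
qed

lemma complex_generating_function_of_real:
  assumes "lam * \<tau> \<ge> 0" "\<bar>x\<bar> < 1"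
  shows "complex_generating_function \<beta> (exp (- lam * \<tau>)) (complex_of_real x) =
           complex_of_real (generating_function \<beta> lam \<tau> x)"
proof -
  define a where "a = 1 - exp (- lam * \<tau>) * x"
  have "\<bar>exp (- lam * \<tau>) * x\<bar> < 1"
    using assms mult_left_le_one_le[of "\<bar>x\<bar>" "exp (- lam * \<tau>)"] by (simp add: abs_mult)
  then have a: "a > 0" by (simp add: a_def)
  have "1 - of_real (exp (- lam * \<tau>)) * complex_of_real x = of_real a"
    by (simp add: a_def)
  moreover have "1 + 1/2 * complex_of_real a = of_real (1 + 1/2 * a)"
    by simp
  moreover have "1 - x / exp (lam * \<tau>) = a"
    by (simp add: a_def exp_minus field_simps)
  ultimately show ?thesis
    unfolding complex_generating_function_def generating_function_def
    using a by (simp only: powr_of_real of_real_mult)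
qed

lemma lcoeff_sums:
  assumes "lam * \<tau> \<ge> 0" "norm z < 1"
  shows "(\<lambda>k. of_real (lcoeff \<beta> lam \<tau> k) * z ^ k) sums
           complex_generating_function \<beta> (exp (- lam * \<tau>)) z"
proof -
  let ?F = "complex_generating_function \<beta> (exp (- lam * \<tau>))"
  have hol: "?F holomorphic_on ball 0 1"
    by (rule complex_generating_function_holomorphic) (use assms in auto)
  have "(deriv ^^ k) ?F 0 / fact k = complex_of_real (lcoeff \<beta> lam \<tau> k)" for k
    unfolding lcoeff_def
    by (intro taylor_coeff_of_real_restriction[OF hol]
        complex_generating_function_of_real assms(1))
  then show ?thesis
    using holomorphic_power_series[OF hol, of z] assms(2) by simp
qed

text \<open>
  A power series that converges at some \<open>s\<close> with \<open>r < s < 1\<close> converges absolutely at \<open>r\<close>.  On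
  the unit circle itself this may fail: without damping (\<open>lam = 0\<close>) and for \<open>\<beta> > 0\<close> the
  generating function is singular at \<open>1\<close>.
\<close>

lemma lcoeff_abs_summable:
  assumes "lam * \<tau> \<ge> 0" "0 \<le> r" "r < 1"
  shows "summable (\<lambda>k. \<bar>lcoeff \<beta> lam \<tau> k\<bar> * r ^ k)"
proof -
  obtain s where s: "r < s" "s < 1" using dense assms by blast
  have "summable (\<lambda>k. of_real (lcoeff \<beta> lam \<tau> k) * complex_of_real s ^ k)"
    using lcoeff_sums[OF assms(1), of "of_real s" \<beta>] s assms by (intro sums_summable) auto
  then have "summable (\<lambda>k. norm (of_real (lcoeff \<beta> lam \<tau> k) * complex_of_real r ^ k))"
    by (rule powser_insidea) (use s assms in auto)
  then show ?thesis
    using assms by (simp add: norm_mult norm_power)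
qed

text \<open>
  Since the coefficients are real, this series is the real part of the generating function at
  \<open>r * cis \<theta>\<close>.
\<close>

lemma lcoeff_cosine_series_nonneg:
  assumes "lam * \<tau> \<ge> 0" "0 \<le> \<beta>" "\<beta> \<le> 1" "0 \<le> r" "r < 1"
  shows "(\<Sum>k. lcoeff \<beta> lam \<tau> k * r ^ k * cos (real k * \<theta>)) \<ge> 0"
proof -
  let ?z = "complex_of_real r * cis \<theta>"
  have z: "norm ?z < 1" using assms by (simp add: norm_mult)
  have "(\<lambda>k. Re (of_real (lcoeff \<beta> lam \<tau> k) * ?z ^ k)) sums
      Re (complex_generating_function \<beta> (exp (- lam * \<tau>)) ?z)"
    by (rule sums_Re[OF lcoeff_sums[OF assms(1) z]])
  moreover have "Re (of_real (lcoeff \<beta> lam \<tau> k) * ?z ^ k) =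
      lcoeff \<beta> lam \<tau> k * r ^ k * cos (real k * \<theta>)" for k
    by (simp add: power_mult_distrib Complex.DeMoivre flip: of_real_power)
  ultimately have "(\<Sum>k. lcoeff \<beta> lam \<tau> k * r ^ k * cos (real k * \<theta>)) =
      Re (complex_generating_function \<beta> (exp (- lam * \<tau>)) ?z)"
    by (simp only: sums_iff)
  then show ?thesis
    using Re_complex_generating_function_nonneg[OF _ _ assms(2,3) z, of "exp (- lam * \<tau>)"] assms(1)
    by simp
qed

section \<open>Quadratic forms of convolution type\<close>

lemma cos_int_mult_has_integral:
  "((\<lambda>\<theta>. cos (of_int p * \<theta>)) has_integral (if p = 0 then 2 * pi else 0)) {0..2 * pi}"
proof (cases "p = 0")
  case True
  then show ?thesis
    using has_integral_const_real[of "1::real" 0 "2 * pi"] by simp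
next
  case False
  have "((\<lambda>\<theta>. cos (of_int p * \<theta>)) has_integral
      sin (of_int p * (2 * pi)) / of_int p - sin (of_int p * 0) / of_int p) {0..2 * pi}"
    by (intro fundamental_theorem_of_calculus)
       (use False in \<open>auto intro!: derivative_eq_intros
          simp flip: has_real_derivative_iff_has_vector_derivative\<close>)
  moreover have "sin (of_int p * (2 * pi)) = 0"
    using sin_int_2pin[of p] by (simp add: mult_ac)
  ultimately show ?thesis using False by simp
qed

lemma cos_mult_cos_has_integral:
  "((\<lambda>\<theta>. cos (real k * \<theta>) * cos (of_int d * \<theta>)) has_integral
     pi * (of_bool (int k = d) + of_bool (int k = - d))) {0..2 * pi}"
proof -
  have "((\<lambda>\<theta>. (cos (of_int (int k - d) * \<theta>) + cos (of_int (int k + d) * \<theta>)) / 2) has_integral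
      ((if int k - d = 0 then 2 * pi else 0) + (if int k + d = 0 then 2 * pi else 0)) / 2) {0..2 * pi}"
    by (intro has_integral_divide has_integral_add cos_int_mult_has_integral)
  moreover have "(cos (of_int (int k - d) * \<theta>) + cos (of_int (int k + d) * \<theta>)) / 2 =
      cos (real k * \<theta>) * cos (of_int d * \<theta>)" for \<theta>
    unfolding cos_times_cos by (simp add: algebra_simps)
  moreover have "((if int k - d = 0 then 2 * pi else 0) + (if int k + d = 0 then 2 * pi else 0)) / 2 =
      pi * (of_bool (int k = d) + of_bool (int k = - d))"
    by (auto simp: of_bool_def)
  ultimately show ?thesis by simp
qed

text \<open>
  By induction on \<open>m\<close>: the new row and the new column contribute equally, and the factor \<open>2\<close> on
  the diagonal makes the corner count twice as well.
\<close>

lemma symmetric_toeplitz_sum: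
  fixes a :: "nat \<Rightarrow> real"
  assumes sym: "\<And>i j. G i j = G j i"
  shows "(\<Sum>i\<le>m. \<Sum>j\<le>m. G i j * (a (nat \<bar>int i - int j\<bar>) * (if i = j then 2 else 1))) =
           2 * (\<Sum>n\<le>m. \<Sum>k\<le>n. a k * G (n - k) n)"
proof (induction m)
  case 0
  then show ?case by simp
next
  case (Suc m)
  let ?t = "\<lambda>i j. G i j * (a (nat \<bar>int i - int j\<bar>) * (if i = j then 2 else 1))"
  have sym_t: "?t i j = ?t j i" for i j
    by (simp add: sym[of i j] abs_minus_commute)
  have "(\<Sum>i\<le>Suc m. \<Sum>j\<le>Suc m. ?t i j) =
      (\<Sum>i\<le>m. \<Sum>j\<le>m. ?t i j) + (\<Sum>i\<le>m. ?t i (Suc m)) + (\<Sum>j\<le>m. ?t (Suc m) j) + ?t (Suc m) (Suc m)"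
    by (simp only: sum.atMost_Suc sum.distrib add.assoc)
  also have "(\<Sum>j\<le>m. ?t (Suc m) j) = (\<Sum>i\<le>m. ?t i (Suc m))"
    by (rule sum.cong[OF refl sym_t])
  also have "(\<Sum>i\<le>m. ?t i (Suc m)) = (\<Sum>i\<le>m. a (Suc m - i) * G i (Suc m))"
  proof (rule sum.cong[OF refl])
    fix i assume "i \<in> {..m}"
    then have "nat \<bar>int i - int (Suc m)\<bar> = Suc m - i" "(i = Suc m) = False"
      by auto
    then show "?t i (Suc m) = a (Suc m - i) * G i (Suc m)"
      by (simp only: if_False mult_1_right mult.commute)
  qed
  also have "(\<Sum>i\<le>m. a (Suc m - i) * G i (Suc m)) = (\<Sum>k=1..Suc m. a k * G (Suc m - k) (Suc m))"
    by (rule sum.reindex_bij_witness[where i = "\<lambda>k. Suc m - k" and j = "\<lambda>i. Suc m - i"])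
       auto
  also have "?t (Suc m) (Suc m) = 2 * (a 0 * G (Suc m - 0) (Suc m))"
    by simp
  also have "(\<Sum>i\<le>m. \<Sum>j\<le>m. ?t i j) + (\<Sum>k=1..Suc m. a k * G (Suc m - k) (Suc m))
      + (\<Sum>k=1..Suc m. a k * G (Suc m - k) (Suc m)) + 2 * (a 0 * G (Suc m - 0) (Suc m)) =
      2 * (\<Sum>n\<le>m. \<Sum>k\<le>n. a k * G (n - k) n) + 2 * (\<Sum>k\<le>Suc m. a k * G (Suc m - k) (Suc m))"
  proof -
    have "(\<Sum>k\<le>Suc m. a k * G (Suc m - k) (Suc m)) =
        a 0 * G (Suc m - 0) (Suc m) + (\<Sum>k=1..Suc m. a k * G (Suc m - k) (Suc m))"
      unfolding atMost_atLeast0 One_nat_def by (rule sum.atLeast_Suc_atMost) simp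
    then show ?thesis
      unfolding Suc.IH by linarith
  qed
  finally show ?case
    by (simp only: sum.atMost_Suc distrib_left)
qed

text \<open>
  The polynomial is the quadratic form of \<open>G\<close> at the complex vector with entries
  \<open>cis (i * \<theta>)\<close>, which is the sum of its values at the real and imaginary parts.
\<close>

lemma trigonometric_gram_nonneg:
  assumes psd: "\<And>c. (\<Sum>i\<le>m. \<Sum>j\<le>m. c i * c j * G i j) \<ge> (0::real)"
  shows "(\<Sum>i\<le>m. \<Sum>j\<le>m. G i j * cos (of_int (int i - int j) * \<theta>)) \<ge> 0"
proof -
  have "cos (of_int (int i - int j) * \<theta>) =
      cos (real i * \<theta>) * cos (real j * \<theta>) + sin (real i * \<theta>) * sin (real j * \<theta>)" for i j
    by (simp add: left_diff_distrib cos_diff)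
  then have "(\<Sum>i\<le>m. \<Sum>j\<le>m. G i j * cos (of_int (int i - int j) * \<theta>)) =
      (\<Sum>i\<le>m. \<Sum>j\<le>m. cos (real i * \<theta>) * cos (real j * \<theta>) * G i j)
      + (\<Sum>i\<le>m. \<Sum>j\<le>m. sin (real i * \<theta>) * sin (real j * \<theta>) * G i j)"
    by (simp add: sum.distrib[symmetric] algebra_simps)
  then show ?thesis
    using psd[of "\<lambda>i. cos (real i * \<theta>)"] psd[of "\<lambda>i. sin (real i * \<theta>)"] by simp
qed

text \<open>
  Orthogonality of the cosines picks out the frequency \<open>\<bar>i - j\<bar>\<close>.  The constant function has
  twice the square norm of the others, whence the doubled diagonal of
  \<open>symmetric_toeplitz_sum\<close>.
\<close>

lemma cosine_sum_against_gram_has_integral: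
  fixes a :: "nat \<Rightarrow> real"
  assumes sym: "\<And>i j. G i j = G j i" and "m < K"
  shows "((\<lambda>\<theta>. (\<Sum>k<K. a k * cos (real k * \<theta>)) *
              (\<Sum>i\<le>m. \<Sum>j\<le>m. G i j * cos (of_int (int i - int j) * \<theta>)))
           has_integral 2 * pi * (\<Sum>n\<le>m. \<Sum>k\<le>n. a k * G (n - k) n)) {0..2 * pi}"
proof -
  let ?\<delta> = "\<lambda>k d. of_bool (int k = d) + of_bool (int k = - d) :: real"
  have "((\<lambda>\<theta>. \<Sum>i\<le>m. \<Sum>j\<le>m. \<Sum>k<K. G i j * a k *
          (cos (real k * \<theta>) * cos (of_int (int i - int j) * \<theta>))) has_integral
      (\<Sum>i\<le>m. \<Sum>j\<le>m. \<Sum>k<K. G i j * a k * (pi * ?\<delta> k (int i - int j)))) {0..2 * pi}"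
    by (intro has_integral_sum has_integral_mult_right cos_mult_cos_has_integral) auto
  moreover have "(\<Sum>k<K. G i j * a k * (pi * ?\<delta> k (int i - int j))) =
      pi * (G i j * (a (nat \<bar>int i - int j\<bar>) * (if i = j then 2 else 1)))"
    if "i \<in> {..m}" "j \<in> {..m}" for i j
  proof -
    have "(\<Sum>k<K. G i j * a k * (pi * ?\<delta> k (int i - int j))) =
        (\<Sum>k<K. if k = nat \<bar>int i - int j\<bar> then pi * (G i j * (a k * (if i = j then 2 else 1))) else 0)"
      by (intro sum.cong) (auto simp: of_bool_def abs_if)
    then show ?thesis
      using that \<open>m < K\<close> by (subst (asm) sum.delta) auto
  qed
  then have "(\<Sum>i\<le>m. \<Sum>j\<le>m. \<Sum>k<K. G i j * a k * (pi * ?\<delta> k (int i - int j))) =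
      2 * pi * (\<Sum>n\<le>m. \<Sum>k\<le>n. a k * G (n - k) n)"
    using symmetric_toeplitz_sum[of G a m, OF sym]
    by (simp add: sum_distrib_left[symmetric])
  moreover have "(\<Sum>i\<le>m. \<Sum>j\<le>m. \<Sum>k<K. G i j * a k *
          (cos (real k * \<theta>) * cos (of_int (int i - int j) * \<theta>))) =
      (\<Sum>k<K. a k * cos (real k * \<theta>)) *
              (\<Sum>i\<le>m. \<Sum>j\<le>m. G i j * cos (of_int (int i - int j) * \<theta>))" for \<theta>
    by (simp add: sum_distrib_left sum_distrib_right mult_ac)
  ultimately show ?thesis
    by (simp only:)
qed

text \<open>
  The form is, up to the factor \<open>2 * pi\<close>, the integral over a period of the cosine series of
  \<open>a\<close> times the trigonometric polynomial of \<open>G\<close>, and both are nonnegative.  Absolute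
  summability allows termwise integration; in fact the integrals of the partial sums are constant
  from the index \<open>m + 1\<close> on.
\<close>

lemma convolution_form_nonneg_of_summable:
  fixes a :: "nat \<Rightarrow> real"
  assumes sym: "\<And>i j. G i j = G j i"
    and psd: "\<And>c. (\<Sum>i\<le>m. \<Sum>j\<le>m. c i * c j * G i j) \<ge> 0"
    and summable: "summable (\<lambda>k. \<bar>a k\<bar>)"
    and symbol: "\<And>\<theta>. (\<Sum>k. a k * cos (real k * \<theta>)) \<ge> 0"
  shows "(\<Sum>n\<le>m. \<Sum>k\<le>n. a k * G (n - k) n) \<ge> 0"
proof -
  let ?Q = "\<lambda>\<theta>. \<Sum>i\<le>m. \<Sum>j\<le>m. G i j * cos (of_int (int i - int j) * \<theta>)"
  let ?A = "\<lambda>K \<theta>. \<Sum>k<K. a k * cos (real k * \<theta>)"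
  let ?H = "\<lambda>\<theta>. \<Sum>k. a k * cos (real k * \<theta>)"
  let ?S = "\<Sum>n\<le>m. \<Sum>k\<le>n. a k * G (n - k) n"
  have bound: "norm (a k * cos (real k * \<theta>)) \<le> \<bar>a k\<bar>" for k \<theta>
    by (simp add: abs_mult mult_left_le)
  have unif: "uniform_limit (cbox 0 (2 * pi)) ?A ?H sequentially"
    by (rule Weierstrass_m_test[OF bound summable])
  have contA: "continuous_on (cbox 0 (2 * pi)) (?A K)" for K
    by (intro continuous_intros)
  have contQ: "continuous_on (cbox 0 (2 * pi)) ?Q"
    by (intro continuous_intros)
  have contH: "continuous_on (cbox 0 (2 * pi)) ?H"
    by (rule uniform_limit_theorem[OF _ unif]) (intro always_eventually allI contA, simp)
  have unifAQ: "uniform_limit (cbox 0 (2 * pi)) (\<lambda>K \<theta>. ?A K \<theta> * ?Q \<theta>) (\<lambda>\<theta>. ?H \<theta> * ?Q \<theta>) sequentially"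
    by (intro uniform_lim_mult[OF unif uniform_limit_const] compact_imp_bounded
        compact_continuous_image contH contQ compact_cbox)
  obtain I J where I: "\<And>K. ((\<lambda>\<theta>. ?A K \<theta> * ?Q \<theta>) has_integral I K) (cbox 0 (2 * pi))"
    and J: "((\<lambda>\<theta>. ?H \<theta> * ?Q \<theta>) has_integral J) (cbox 0 (2 * pi))"
    and lim: "I \<longlonglongrightarrow> J"
    using uniform_limit_integral_cbox[OF unifAQ continuous_on_mult[OF contA contQ] sequentially_bot]
    by blast
  have "I K = 2 * pi * ?S" if "m < K" for K
    using has_integral_unique[OF I[of K, unfolded cbox_interval]
        cosine_sum_against_gram_has_integral[OF sym that]] .
  then have "eventually (\<lambda>K. I K = 2 * pi * ?S) sequentially"
    by (intro eventually_mono[OF eventually_gt_at_top[of m]])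
  then have "J = 2 * pi * ?S"
    using lim tendsto_eventually LIMSEQ_unique by blast
  moreover have "J \<ge> 0"
    by (rule has_integral_nonneg[OF J])
       (intro mult_nonneg_nonneg symbol trigonometric_gram_nonneg psd)
  ultimately show ?thesis
    using pi_gt_zero by (simp add: zero_le_mult_iff not_le[symmetric])
qed

text \<open>
  Damping by \<open>r ^ k\<close> with \<open>r < 1\<close> provides the summability, and the finite sum is continuous
  in \<open>r\<close>, so that \<open>r\<close> may tend to \<open>1\<close>.
\<close>

lemma convolution_form_nonneg:
  fixes l :: "nat \<Rightarrow> real"
  assumes sym: "\<And>i j. G i j = G j i"
    and psd: "\<And>c. (\<Sum>i\<le>m. \<Sum>j\<le>m. c i * c j * G i j) \<ge> 0"
    and summable: "\<And>r. 0 \<le> r \<Longrightarrow> r < 1 \<Longrightarrow> summable (\<lambda>k. \<bar>l k\<bar> * r ^ k)"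
    and symbol: "\<And>r \<theta>. 0 \<le> r \<Longrightarrow> r < 1 \<Longrightarrow> (\<Sum>k. l k * r ^ k * cos (real k * \<theta>)) \<ge> 0"
  shows "(\<Sum>n\<le>m. \<Sum>k\<le>n. l k * G (n - k) n) \<ge> 0"
proof -
  let ?S = "\<lambda>r. \<Sum>n\<le>m. \<Sum>k\<le>n. l k * r ^ k * G (n - k) n"
  have "(?S \<longlongrightarrow> ?S 1) (at_left 1)"
    by (intro tendsto_intros)
  moreover have "eventually (\<lambda>r. 0 \<le> ?S r) (at_left 1)"
  proof (rule eventually_at_leftI[of 0])
    fix r :: real assume "r \<in> {0<..<1}"
    then show "0 \<le> ?S r"
      using summable[of r] symbol[of r]
      by (intro convolution_form_nonneg_of_summable sym psd) (auto simp: abs_mult)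
  qed simp
  ultimately have "0 \<le> ?S 1"
    by (rule tendsto_lowerbound) simp
  then show ?thesis by simp
qed

section \<open>The energy estimate\<close>

lemma grid_norm_eq_L2_set:
  assumes "h \<ge> 0"
  shows "grid_norm h M v = sqrt h * L2_set v {1..M-1}"
  using assms by (simp add: grid_norm_def grid_inner_def L2_set_def real_sqrt_mult power2_eq_square)

lemma grid_norm_nonneg: "h \<ge> 0 \<Longrightarrow> grid_norm h M v \<ge> 0"
  by (simp add: grid_norm_eq_L2_set)

lemma grid_norm_power2: "h \<ge> 0 \<Longrightarrow> (grid_norm h M v)\<^sup>2 = grid_inner h M v v"
  by (simp add: grid_norm_def grid_inner_def sum_nonneg)

lemma grid_inner_le_grid_norm_mult:
  assumes "h \<ge> 0"
  shows "grid_inner h M v w \<le> grid_norm h M v * grid_norm h M w"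
proof -
  have "(\<Sum>i=1..M-1. v i * w i) \<le> (\<Sum>i=1..M-1. \<bar>v i\<bar> * \<bar>w i\<bar>)"
    by (intro sum_mono) (simp flip: abs_mult)
  also have "\<dots> \<le> L2_set v {1..M-1} * L2_set w {1..M-1}"
    by (rule L2_set_mult_ineq)
  finally have "h * (\<Sum>i=1..M-1. v i * w i) \<le> h * (L2_set v {1..M-1} * L2_set w {1..M-1})"
    using assms by (rule mult_left_mono)
  also have "\<dots> = (sqrt h * sqrt h) * (L2_set v {1..M-1} * L2_set w {1..M-1})"
    using assms by simp
  also have "\<dots> = grid_norm h M v * grid_norm h M w"
    unfolding grid_norm_eq_L2_set[OF assms] by (simp only: mult_ac)
  finally show ?thesis
    by (simp add: grid_inner_def)
qed

lemma grid_norm_triangle: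
  assumes "h \<ge> 0"
  shows "grid_norm h M (\<lambda>i. v i + w i) \<le> grid_norm h M v + grid_norm h M w"
  using assms L2_set_triangle_ineq[of v w "{1..M-1}"]
  by (simp add: grid_norm_eq_L2_set mult_left_mono flip: distrib_left)

lemma grid_norm_le_sup:
  assumes "b \<ge> 0" "M \<ge> 1" "h = b / real M" "\<rho> \<ge> 0"
    and "\<And>i. i \<in> {1..M-1} \<Longrightarrow> \<bar>v i\<bar> \<le> \<rho>"
  shows "grid_norm h M v \<le> sqrt b * \<rho>"
proof -
  have "(\<Sum>i=1..M-1. v i * v i) \<le> (\<Sum>i=1..M-1. \<rho>\<^sup>2)"
    using assms(5) by (intro sum_mono) (simp add: power2_eq_square abs_le_square_iff[symmetric] \<open>\<rho> \<ge> 0\<close>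
        flip: power2_eq_square)
  also have "\<dots> \<le> real M * \<rho>\<^sup>2"
    by (simp add: mult_right_mono)
  finally have "grid_inner h M v v \<le> h * (real M * \<rho>\<^sup>2)"
    unfolding grid_inner_def using assms by (intro mult_left_mono) auto
  also have "\<dots> = b * \<rho>\<^sup>2"
    using assms by simp
  finally show ?thesis
    unfolding grid_norm_def using real_sqrt_le_mono[of _ "b * \<rho>\<^sup>2"] assms(4)
    by (fastforce simp: real_sqrt_mult)
qed

lemma grid_inner_commute: "grid_inner h M v w = grid_inner h M w v"
  by (simp add: grid_inner_def mult.commute)

lemma grid_inner_linear_combination:
  "grid_inner h M (\<lambda>i. \<Sum>p\<in>P. c p * v p i) w = (\<Sum>p\<in>P. c p * grid_inner h M (v p) w)"
  unfolding grid_inner_def sum_distrib_left sum_distrib_right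
  by (subst sum.swap) (simp add: mult_ac)

lemma discrete_riesz_linear_combination:
  "discrete_riesz \<alpha> h M (\<lambda>j. \<Sum>p\<in>P. c p * v p j) = (\<lambda>i. \<Sum>p\<in>P. c p * discrete_riesz \<alpha> h M (v p) i)"
  unfolding discrete_riesz_def sum_distrib_left
  by (subst sum.swap) (simp add: mult_ac)

lemma discrete_riesz_diff:
  "discrete_riesz \<alpha> h M (\<lambda>j. v j - w j) i = discrete_riesz \<alpha> h M v i - discrete_riesz \<alpha> h M w i"
  by (simp add: discrete_riesz_def sum_subtractf right_diff_distrib)

text \<open>
  The kernel \<open>G\<close> is the Gram matrix of the time levels \<open>v 0, v 1, \<dots>\<close> with respect to the
  positive semidefinite form of the negative discrete Riesz derivative.
\<close>

lemma memory_dissipative: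
  assumes "1 < \<alpha>" "\<alpha> \<le> 2" "h > 0" "0 \<le> \<beta>" "\<beta> \<le> 1" "lam * \<tau> \<ge> 0"
  shows "(\<Sum>n\<le>m. \<Sum>k\<le>n. lcoeff \<beta> lam \<tau> k *
           grid_inner h M (discrete_riesz \<alpha> h M (v (n - k))) (v n)) \<le> 0"
proof -
  define G where "G i j = - grid_inner h M (discrete_riesz \<alpha> h M (v i)) (v j)" for i j
  have "(\<Sum>n\<le>m. \<Sum>k\<le>n. lcoeff \<beta> lam \<tau> k * G (n - k) n) \<ge> 0"
  proof (rule convolution_form_nonneg)
    show "G i j = G j i" for i j
      by (simp add: G_def discrete_riesz_symmetric[of h M \<alpha> "v i"])
    show "(\<Sum>i\<le>m. \<Sum>j\<le>m. c i * c j * G i j) \<ge> 0" for c :: "nat \<Rightarrow> real"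
    proof -
      let ?V = "\<lambda>x. \<Sum>i\<le>m. c i * v i x"
      have "grid_inner h M (discrete_riesz \<alpha> h M ?V) ?V =
          (\<Sum>i\<le>m. c i * (\<Sum>j\<le>m. c j * grid_inner h M (discrete_riesz \<alpha> h M (v i)) (v j)))"
        unfolding discrete_riesz_linear_combination grid_inner_linear_combination
        by (subst grid_inner_commute, subst grid_inner_linear_combination)
           (simp add: grid_inner_commute)
      then have "(\<Sum>i\<le>m. \<Sum>j\<le>m. c i * c j * G i j) = - grid_inner h M (discrete_riesz \<alpha> h M ?V) ?V"
        by (simp add: G_def sum_negf sum_distrib_left mult.assoc)
      then show ?thesis
        using discrete_riesz_dissipative[OF assms(1-3)] by simp
    qed
  qed (use assms lcoeff_abs_summable lcoeff_cosine_series_nonneg in auto)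
  then show ?thesis
    by (simp add: G_def sum_negf)
qed

text \<open>
  Testing with \<open>v n = e\<^sup>n\<^sup>+\<^sup>1 + e\<^sup>n\<close> turns the time difference into a difference of squared
  norms (\<open>increment\<close>).  After summation the memory term has a sign and is dropped
  (\<open>energy\<close>).  What remains is quadratic in the norms on the left and linear on the right, so at
  the time level where the norm is largest one factor cancels; this is why the
  constant grows only linearly in \<open>N\<close>.
\<close>

lemma scheme_stability:
  fixes e R :: "nat \<Rightarrow> nat \<Rightarrow> real"
  assumes "1 < \<alpha>" "\<alpha> \<le> 2" "1 < \<gamma>" "\<gamma> \<le> 2" "lam * \<tau> \<ge> 0"
    and "b > 0" "M \<ge> 1" and h: "h = b / real M"
    and step: "\<And>i n. i \<in> {1..M-1} \<Longrightarrow> n < N \<Longrightarrow> e i (Suc n) - e i n =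
        \<tau> powr \<gamma> / 2 * (\<Sum>k\<le>n. lcoeff (\<gamma> - 1) lam \<tau> k *
          discrete_riesz \<alpha> h M (\<lambda>j. e j (Suc (n - k)) + e j (n - k)) i) + R i n"
    and init: "\<And>i. i \<in> {1..M-1} \<Longrightarrow> e i 0 = 0"
    and R: "\<And>i n. i \<in> {1..M-1} \<Longrightarrow> n < N \<Longrightarrow> \<bar>R i n\<bar> \<le> \<rho>" and "\<rho> \<ge> 0"
    and "n \<le> N"
  shows "grid_norm h M (\<lambda>i. e i n) \<le> 2 * real N * (sqrt b * \<rho>)"
proof -
  define v where "v = (\<lambda>n i. e i (Suc n) + e i n)"
  define a where "a n = grid_norm h M (\<lambda>i. e i n)" for n
  have hpos: "h > 0" using assms by simp
  have a_nonneg: "a n \<ge> 0" for n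
    using hpos by (simp add: a_def grid_norm_nonneg)
  have a0: "a 0 = 0"
    using init by (simp add: a_def grid_norm_def grid_inner_def)
  have increment: "(a (Suc n))\<^sup>2 - (a n)\<^sup>2 =
      \<tau> powr \<gamma> / 2 * (\<Sum>k\<le>n. lcoeff (\<gamma> - 1) lam \<tau> k *
        grid_inner h M (discrete_riesz \<alpha> h M (v (n - k))) (v n))
      + grid_inner h M (\<lambda>i. R i n) (v n)" if "n < N" for n
  proof -
    let ?D = "\<lambda>i. \<Sum>k\<le>n. lcoeff (\<gamma> - 1) lam \<tau> k * discrete_riesz \<alpha> h M (v (n - k)) i"
    have "(a (Suc n))\<^sup>2 - (a n)\<^sup>2 =
        h * (\<Sum>i=1..M-1. e i (Suc n) * e i (Suc n) - e i n * e i n)"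
      using hpos by (simp add: a_def grid_norm_power2 grid_inner_def sum_subtractf right_diff_distrib)
    also have "\<dots> = h * (\<Sum>i=1..M-1. (e i (Suc n) - e i n) * v n i)"
      by (simp add: v_def algebra_simps)
    also have "\<dots> = h * (\<Sum>i=1..M-1. (\<tau> powr \<gamma> / 2 * ?D i + R i n) * v n i)"
      unfolding v_def using step[OF _ that] by simp
    also have "\<dots> = \<tau> powr \<gamma> / 2 * grid_inner h M ?D (v n) + grid_inner h M (\<lambda>i. R i n) (v n)"
      by (simp add: grid_inner_def distrib_right distrib_left sum.distrib sum_distrib_left mult_ac)
    finally show ?thesis
      by (simp only: grid_inner_linear_combination)
  qed
  have forcing: "grid_inner h M (\<lambda>i. R i n) (v n) \<le> sqrt b * \<rho> * (a (Suc n) + a n)" if "n < N" for n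
  proof -
    have "grid_inner h M (\<lambda>i. R i n) (v n) \<le> grid_norm h M (\<lambda>i. R i n) * grid_norm h M (v n)"
      using hpos by (intro grid_inner_le_grid_norm_mult) auto
    also have "\<dots> \<le> (sqrt b * \<rho>) * (a (Suc n) + a n)"
    proof (intro mult_mono)
      show "grid_norm h M (\<lambda>i. R i n) \<le> sqrt b * \<rho>"
        using assms R[OF _ that] by (intro grid_norm_le_sup) auto
      show "grid_norm h M (v n) \<le> a (Suc n) + a n"
        unfolding v_def a_def using hpos by (intro grid_norm_triangle) auto
    qed (use assms hpos grid_norm_nonneg in auto)
    finally show ?thesis .
  qed
  have energy: "(a (Suc m))\<^sup>2 \<le> (\<Sum>n\<le>m. sqrt b * \<rho> * (a (Suc n) + a n))" if "m < N" for m
  proof -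
    have "(a (Suc m))\<^sup>2 = (\<Sum>n\<le>m. (a (Suc n))\<^sup>2 - (a n)\<^sup>2)"
      using sum_telescope[of "\<lambda>n. - (a n)\<^sup>2" m] a0 by simp
    also have "\<dots> = \<tau> powr \<gamma> / 2 * (\<Sum>n\<le>m. \<Sum>k\<le>n. lcoeff (\<gamma> - 1) lam \<tau> k *
        grid_inner h M (discrete_riesz \<alpha> h M (v (n - k))) (v n))
        + (\<Sum>n\<le>m. grid_inner h M (\<lambda>i. R i n) (v n))"
      unfolding sum_distrib_left[of _ _ "{..m}"] sum.distrib[symmetric]
      using that by (intro sum.cong refl increment) auto
    also have "\<dots> \<le> 0 + (\<Sum>n\<le>m. sqrt b * \<rho> * (a (Suc n) + a n))"
    proof (rule add_mono)
      show "\<tau> powr \<gamma> / 2 * (\<Sum>n\<le>m. \<Sum>k\<le>n. lcoeff (\<gamma> - 1) lam \<tau> k *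
          grid_inner h M (discrete_riesz \<alpha> h M (v (n - k))) (v n)) \<le> 0"
        using assms hpos by (intro mult_nonneg_nonpos memory_dissipative) auto
      show "(\<Sum>n\<le>m. grid_inner h M (\<lambda>i. R i n) (v n)) \<le> (\<Sum>n\<le>m. sqrt b * \<rho> * (a (Suc n) + a n))"
        using that by (intro sum_mono forcing) auto
    qed
    finally show ?thesis by simp
  qed
  define E where "E = Max (a ` {..N})"
  have le_E: "a k \<le> E" if "k \<le> N" for k
    using that by (simp add: E_def)
  have bound_nonneg: "0 \<le> sqrt b * \<rho>"
    using assms by simp
  have "E \<in> a ` {..N}"
    unfolding E_def by (intro Max_in) auto
  then obtain k where k: "k \<le> N" "E = a k" by auto
  have "E \<le> 2 * real N * (sqrt b * \<rho>)"
  proof (cases "E = 0")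
    case True
    then show ?thesis using bound_nonneg by simp
  next
    case False
    then obtain m where m: "k = Suc m"
      using k a0 by (cases k) auto
    have "E * E \<le> (\<Sum>n\<le>m. sqrt b * \<rho> * (a (Suc n) + a n))"
      using energy[of m] k m by (simp add: power2_eq_square)
    also have "\<dots> \<le> (\<Sum>n\<le>m. sqrt b * \<rho> * (E + E))"
      using k m bound_nonneg by (intro sum_mono mult_left_mono add_mono le_E) auto
    also have "\<dots> = real k * (sqrt b * \<rho> * (E + E))"
      by (simp add: m)
    also have "\<dots> \<le> real N * (sqrt b * \<rho> * (E + E))"
      using k assms(6) \<open>\<rho> \<ge> 0\<close> a_nonneg[of k]
      by (intro mult_right_mono mult_nonneg_nonneg) auto
    also have "\<dots> = (2 * real N * (sqrt b * \<rho>)) * E"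
      by simp
    finally show ?thesis
      using False k a_nonneg[of k] by (simp add: mult_le_cancel_right)
  qed
  then show ?thesis
    using le_E[OF \<open>n \<le> N\<close>] by (simp add: a_def)
qed

theorem theorem3p2:
  fixes b T \<alpha> \<gamma> lam C h \<tau> :: real
    and M N :: nat
    and f u :: "real \<Rightarrow> real \<Rightarrow> real"
    and U :: "nat \<Rightarrow> nat \<Rightarrow> real"
  assumes "b > 0" and "T > 0"
    and "1 < \<alpha>" and "\<alpha> \<le> 2"
    and "1 < \<gamma>" and "\<gamma> \<le> 2"
    and "lam \<ge> 0"
    and "exact_solution b T \<alpha> \<gamma> lam f u"
    and "C > 0"
    and "M \<ge> 2" and "N \<ge> 1"
    and "h = b / real M" and "\<tau> = T / real N"
    and "scheme_solution \<alpha> \<gamma> lam h \<tau> M N f U"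
    and "\<And>i n. 1 \<le> i \<Longrightarrow> i \<le> M - 1 \<Longrightarrow> n \<le> N - 1 \<Longrightarrow>
           \<bar>residual \<alpha> \<gamma> lam h \<tau> M f u i n\<bar> \<le> C * \<tau> * (\<tau>\<^sup>2 + h\<^sup>2)"
  shows "\<forall>n\<le>N. grid_norm h M (\<lambda>i. u (real i * h) (real n * \<tau>) - U i n)
           \<le> 2 * C * sqrt b * T * (\<tau>\<^sup>2 + h\<^sup>2)"
proof (intro allI impI)
  fix n assume "n \<le> N"
  define e where "e i n = u (real i * h) (real n * \<tau>) - U i n" for i n
  let ?l = "lcoeff (\<gamma> - 1) lam \<tau>"
  have "\<tau> > 0" using assms by simp
  have "grid_norm h M (\<lambda>i. e i n) \<le> 2 * real N * (sqrt b * (C * \<tau> * (\<tau>\<^sup>2 + h\<^sup>2)))"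
  proof (rule scheme_stability[where R = "residual \<alpha> \<gamma> lam h \<tau> M f u" and \<gamma> = \<gamma> and \<tau> = \<tau>
        and lam = lam and \<alpha> = \<alpha>])
    fix i n assume i: "i \<in> {1..M-1}" and n: "n < N"
    let ?u = "\<lambda>k j. u (real j * h) (real (n + 1 - k) * \<tau>) + u (real j * h) (real (n - k) * \<tau>)"
    let ?U = "\<lambda>k j. U j (n + 1 - k) + U j (n - k)"
    have U: "U i (n + 1) - U i n = \<tau> powr \<gamma> / 2 *
          (\<Sum>k=0..n. ?l k * discrete_riesz \<alpha> h M (?U k) i)
          + \<tau> * f (real i * h) ((real n + 1/2) * \<tau>)"
      using assms(14) i n by (simp add: scheme_solution_def)
    have u: "u (real i * h) (real (n + 1) * \<tau>) - u (real i * h) (real n * \<tau>) = \<tau> powr \<gamma> / 2 *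
          (\<Sum>k=0..n. ?l k * discrete_riesz \<alpha> h M (?u k) i)
          + \<tau> * f (real i * h) ((real n + 1/2) * \<tau>) + residual \<alpha> \<gamma> lam h \<tau> M f u i n"
      unfolding residual_def by simp
    have "discrete_riesz \<alpha> h M (\<lambda>j. e j (Suc (n - k)) + e j (n - k)) i =
        discrete_riesz \<alpha> h M (?u k) i - discrete_riesz \<alpha> h M (?U k) i" if "k \<le> n" for k
      unfolding discrete_riesz_diff[symmetric] using that
      by (simp add: e_def Suc_diff_le algebra_simps)
    then have "(\<Sum>k\<le>n. ?l k * discrete_riesz \<alpha> h M (\<lambda>j. e j (Suc (n - k)) + e j (n - k)) i) =
        (\<Sum>k\<le>n. ?l k * discrete_riesz \<alpha> h M (?u k) i - ?l k * discrete_riesz \<alpha> h M (?U k) i)"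
      by (intro sum.cong) (auto simp: right_diff_distrib)
    also have "\<dots> = (\<Sum>k=0..n. ?l k * discrete_riesz \<alpha> h M (?u k) i)
        - (\<Sum>k=0..n. ?l k * discrete_riesz \<alpha> h M (?U k) i)"
      by (simp only: sum_subtractf atMost_atLeast0)
    finally have "\<tau> powr \<gamma> / 2 *
          (\<Sum>k\<le>n. ?l k * discrete_riesz \<alpha> h M (\<lambda>j. e j (Suc (n - k)) + e j (n - k)) i) =
        \<tau> powr \<gamma> / 2 * (\<Sum>k=0..n. ?l k * discrete_riesz \<alpha> h M (?u k) i)
        - \<tau> powr \<gamma> / 2 * (\<Sum>k=0..n. ?l k * discrete_riesz \<alpha> h M (?U k) i)"
      by (simp only: right_diff_distrib)
    with u U show "e i (Suc n) - e i n = \<tau> powr \<gamma> / 2 *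
          (\<Sum>k\<le>n. ?l k * discrete_riesz \<alpha> h M (\<lambda>j. e j (Suc (n - k)) + e j (n - k)) i)
          + residual \<alpha> \<gamma> lam h \<tau> M f u i n"
      unfolding e_def Suc_eq_plus1 by linarith
  next
    fix i assume i: "i \<in> {1..M-1}"
    have "real i * h \<le> real M * h"
      using i assms by (intro mult_right_mono) auto
    then have "real i * h \<in> {0..b}"
      using assms by auto
    then show "e i 0 = 0"
      using assms(8,14) i by (auto simp: e_def exact_solution_def scheme_solution_def)
  qed (use assms \<open>\<tau> > 0\<close> \<open>n \<le> N\<close> in auto)
  also have "\<dots> = 2 * C * sqrt b * (real N * \<tau>) * (\<tau>\<^sup>2 + h\<^sup>2)"
    by simp
  also have "real N * \<tau> = T"
    using assms by simp
  finally show "grid_norm h M (\<lambda>i. u (real i * h) (real n * \<tau>) - U i n)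
      \<le> 2 * C * sqrt b * T * (\<tau>\<^sup>2 + h\<^sup>2)"
    by (simp add: e_def)
qed

end
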